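(* Let $(B_3,B_3^+)$ be the braid group and braid monoid with generating set $S_2=\{s_1,s_2\}$ and the single relation $s_1s_2s_1=s_2s_1s_2$. Then the collection $\mathcal{A}_{S_2}$ is an algebra of subsets of $P=B_3^+$.
   Context: $B_3^+$ is the monoid $\langle s_1,s_2\mid s_1s_2s_1=s_2s_1s_2\rangle$. For finite $K\subset P$, $\Omega_K=\bigcap_{k\in K}(P\setminus kP)$, with $\Omega_\emptyset=P$. $\mathcal{A}_{S_2}$ is the collection of all finite (possibly empty) disjoint unions of sets $p\Omega_K$ with $p\in P$ and $K\subset S_2$ (possibly empty). An algebra of subsets of $P$ is a nonempty collection closed under complements and finite unions. *)

theory Defs
  imports "HOL-Analysis.Sigma_Algebra" "HOL-Library.Disjoint_Sets"
begin

datatype braid_gen = S1 | S2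

(* The least monoid congruence on the free monoid of words (lists under append)
   that identifies the two sides of the braid relation. *)
inductive braid_cong :: "braid_gen list \<Rightarrow> braid_gen list \<Rightarrow> bool" where
  braid: "braid_cong [S1, S2, S1] [S2, S1, S2]"
| refl: "braid_cong u u"
| sym: "braid_cong u v \<Longrightarrow> braid_cong v u"
| trans: "braid_cong u v \<Longrightarrow> braid_cong v w \<Longrightarrow> braid_cong u w"
| append: "braid_cong u u' \<Longrightarrow> braid_cong v v' \<Longrightarrow> braid_cong (u @ v) (u' @ v')"

lemma equivp_braid_cong: "equivp braid_cong"
  by (intro equivpI reflpI sympI transpI) (blast intro: braid_cong.intros)+

(* The monoid presented by generators s1, s2 and relation s1 s2 s1 = s2 s1 s2. *)
quotient_type braid_monoid3 = "braid_gen list" / braid_cong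
  by (rule equivp_braid_cong)

instantiation braid_monoid3 :: monoid_mult
begin

lift_definition one_braid_monoid3 :: braid_monoid3 is "[]" .

lift_definition times_braid_monoid3 :: "braid_monoid3 \<Rightarrow> braid_monoid3 \<Rightarrow> braid_monoid3"
  is "(@)" by (rule braid_cong.append)

instance
  by standard (transfer; simp add: braid_cong.refl)+

end

lift_definition s1 :: braid_monoid3 is "[S1]" .

lift_definition s2 :: braid_monoid3 is "[S2]" .

definition braid_gens :: "braid_monoid3 set" where
  "braid_gens = {s1, s2}"

lemma braid_relation: "s1 * s2 * s1 = s2 * s1 * s2"
  by transfer (simp add: braid_cong.braid)

(* In the following two definitions the monoid P is the whole type 'a;
   p P is the image of UNIV under left multiplication by p. *)
definition Omega :: "'a::monoid_mult set \<Rightarrow> 'a set" where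
  "Omega K = (\<Inter>k\<in>K. UNIV - (*) k ` UNIV)"

definition disjoint_unions :: "'a::monoid_mult set \<Rightarrow> 'a set set" where
  "disjoint_unions S =
     {\<Union>F | F. finite F \<and> disjoint F \<and>
               (\<forall>X\<in>F. \<exists>p K. finite K \<and> K \<subseteq> S \<and> X = (*) p ` Omega K)}"

(* The library's algebra agrees with: a nonempty collection of subsets closed
   under complements and (binary, hence finite) unions. *)
lemma algebra_iff_nonempty:
  "algebra \<Omega> M \<longleftrightarrow>
     M \<subseteq> Pow \<Omega> \<and> M \<noteq> {} \<and> (\<forall>A\<in>M. \<Omega> - A \<in> M) \<and> (\<forall>A\<in>M. \<forall>B\<in>M. A \<union> B \<in> M)"
proof
  assume "algebra \<Omega> M"
  then show "M \<subseteq> Pow \<Omega> \<and> M \<noteq> {} \<and> (\<forall>A\<in>M. \<Omega> - A \<in> M) \<and> (\<forall>A\<in>M. \<forall>B\<in>M. A \<union> B \<in> M)"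
    unfolding algebra_iff_Un by blast
next
  assume *: "M \<subseteq> Pow \<Omega> \<and> M \<noteq> {} \<and> (\<forall>A\<in>M. \<Omega> - A \<in> M) \<and> (\<forall>A\<in>M. \<forall>B\<in>M. A \<union> B \<in> M)"
  then obtain A where A: "A \<in> M" by blast
  with * have "\<Omega> - A \<in> M" "A \<subseteq> \<Omega>" by blast+
  with * A have "A \<union> (\<Omega> - A) \<in> M" by blast
  with \<open>A \<subseteq> \<Omega>\<close> have "\<Omega> \<in> M" by (simp add: Un_absorb1)
  with * have "\<Omega> - \<Omega> \<in> M" by blast
  with * show "algebra \<Omega> M"
    unfolding algebra_iff_Un by simp
qed

end

theory Submission
  imports Defs
begin

text \<open>
  Write \<open>P\<close> for the monoid. The proof rests on two properties of \<open>P\<close>, both due to Garside: it is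
  left cancellative, and for the two generators \<open>s \<noteq> t\<close> every common right multiple of \<open>s\<close> and \<open>t\<close>
  is a multiple of \<open>s t s = t s t\<close>. They are proved together, by induction on the length of words
  (lemma \<open>braid_cong_matched\<close>).

  The second property says that \<open>s x \<in> t P\<close> means \<open>x \<in> t s P\<close>. Moving a generator past another
  thus produces products of two generators, and the point of the proof is that this process
  stays finite: the elements \<open>1, s, t, s t, t s\<close> have the property that, whenever one of them
  (say \<open>w\<close>) and a generator \<open>t\<close> are completed to a least common multiple \<open>w v = t w'\<close>, the
  complements \<open>v\<close> and \<open>w'\<close> again lie in this list (lemma \<open>simple_complement\<close>). Statements about
  \<open>q \<Omega>\<^sub>K\<close> for all \<open>w\<close> in the list at once can therefore be proved by induction on the number of
  generators in \<open>q\<close>. In this way the collection of disjoint unions is shown to be closed under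
  removing \<open>w P\<close> and under inverse images along \<open>x \<mapsto> w x\<close>, hence along \<open>x \<mapsto> p x\<close> for every \<open>p\<close>.

  Closure under intersection follows, since
  \<open>X \<inter> p \<Omega>\<^sub>K = p (p\<inverse> X \<inter> \<Omega>\<^sub>K)\<close>, where \<open>p\<inverse> X\<close> is the inverse image and intersecting with \<open>\<Omega>\<^sub>K\<close>
  removes \<open>k P\<close> for \<open>k \<in> K\<close>. The complement of \<open>t Y\<close> is the disjoint union of \<open>\<Omega>\<^bsub>{t}\<^esub>\<close> and \<open>t (P - Y)\<close>, so
  complements of the sets \<open>q \<Omega>\<^sub>K\<close> are again obtained by induction on \<open>q\<close>, and complements of their
  finite unions by intersecting.
\<close>

section \<open>Cancellation and common multiples\<close>

lemma braid_cong_length: "braid_cong u v \<Longrightarrow> length u = length v"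
  by (induction rule: braid_cong.induct) auto

lemma braid_cong_Cons: "braid_cong u v \<Longrightarrow> braid_cong (a # u) (a # v)"
  using braid_cong.append[OF braid_cong.refl[of "[a]"]] by simp

lemma braid_cong_braid:
  "a \<noteq> b \<Longrightarrow> braid_cong (a # b # a # u) (b # a # b # u)"
  using braid_cong.append[OF braid_cong.braid braid_cong.refl[of u]]
  by (cases a; cases b) (simp_all add: braid_cong.sym)

text \<open>
  The relation that Garside's two properties predict between congruent words: it
  reads off, from the first letters, how the remainders must be related.
\<close>

fun matched :: "braid_gen list \<Rightarrow> braid_gen list \<Rightarrow> bool" where
  "matched [] [] = True"
| "matched (a # u) (b # v) =
     (if a = b then braid_cong u v
      else \<exists>z. braid_cong u (b # a # z) \<and> braid_cong v (a # b # z))"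
| "matched _ _ = False"

lemma matched_refl: "matched u u"
  by (cases u) (auto intro: braid_cong.refl)

lemma matched_sym: "matched u v \<Longrightarrow> matched v u"
  by (cases "(u, v)" rule: matched.cases) (auto split: if_splits intro: braid_cong.sym)

lemma matched_append:
  assumes "matched u u'" "matched v v'" "braid_cong v v'"
  shows "matched (u @ v) (u' @ v')"
proof (cases "(u, u')" rule: matched.cases)
  case 1
  then show ?thesis using assms by simp
next
  case (2 a x b y)
  show ?thesis
  proof (cases "a = b")
    case True
    then show ?thesis using assms 2 by (auto intro: braid_cong.append)
  next
    case False
    then obtain z where "braid_cong x (b # a # z)" "braid_cong y (a # b # z)"
      using assms 2 by auto
    then have "braid_cong (x @ v) (b # a # (z @ v))" "braid_cong (y @ v') (a # b # (z @ v))"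
      using braid_cong.append[of x "b # a # z" v v] braid_cong.append[of y "a # b # z" v' v]
        assms(3) braid_cong.refl braid_cong.sym by (metis append_Cons)+
    then show ?thesis using False 2 by auto
  qed
qed (use assms in auto)

text \<open>
  Transitivity is where cancellation enters. If the first letters are \<open>a, b, a\<close> with
  \<open>a \<noteq> b\<close>, the middle word provides two continuations after the letters \<open>a b\<close>,
  and these have to be congruent: the letters \<open>a\<close> and \<open>b\<close> are cancelled in turn, each time from
  words that are shorter than the middle one.
\<close>

lemma matched_trans:
  assumes cancel: "\<And>a x y. length x < n \<Longrightarrow> braid_cong (a # x) (a # y) \<Longrightarrow> braid_cong x y"
    and uv: "matched u v" and vw: "matched v w" and len: "length v \<le> Suc n"
  shows "matched u w"
proof (cases "(u, v)" rule: matched.cases)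
  case 1
  then show ?thesis using vw by simp
next
  case (2 a x b y)
  then obtain c z where w: "w = c # z"
    using vw by (cases w) auto
  consider "a = b" "b = c" | "a = b" "b \<noteq> c" | "a \<noteq> b" "b = c" | "a \<noteq> b" "b \<noteq> c" "a = c"
    by (metis braid_gen.exhaust)
  then show ?thesis
  proof cases
    case 1
    then show ?thesis using uv vw 2 w by (auto intro: braid_cong.trans)
  next
    case c2: 2
    then show ?thesis using uv vw 2 w by (auto intro: braid_cong.trans)
  next
    case 3
    then obtain r where r: "braid_cong x (b # a # r)" "braid_cong y (a # b # r)"
      using uv 2 by auto
    have "braid_cong z y" using 3 vw 2 w by (auto intro: braid_cong.sym)
    then have "braid_cong z (a # b # r)" using r(2) by (rule braid_cong.trans)
    then show ?thesis using r(1) 2 w 3 by auto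
  next
    case 4
    then obtain r where r: "braid_cong x (b # a # r)" "braid_cong y (a # b # r)"
      using uv 2 by auto
    obtain r' where r': "braid_cong y (a # b # r')" "braid_cong z (b # a # r')"
      using vw 2 w 4 by auto
    have "braid_cong (a # b # r) (a # b # r')"
      using r r' braid_cong.trans braid_cong.sym by blast
    moreover have "length (b # r) < n"
      using braid_cong_length[OF r(2)] len 2 by simp
    ultimately have "braid_cong (b # r) (b # r')" using cancel by blast
    then have "braid_cong r r'"
      using cancel \<open>length (b # r) < n\<close> by simp
    then have "braid_cong x z"
      using r(1) r'(2) braid_cong_Cons braid_cong.trans braid_cong.sym by meson
    then show ?thesis using 2 w 4 by simp
  qed
qed (use uv in auto)

lemma braid_cong_matched_step:
  assumes cancel: "\<And>a x y. length x < n \<Longrightarrow> braid_cong (a # x) (a # y) \<Longrightarrow> braid_cong x y"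
    and "braid_cong u v" "length u \<le> Suc n"
  shows "matched u v"
  using assms(2,3)
proof (induction rule: braid_cong.induct)
  case braid
  then show ?case by (auto intro: braid_cong.refl exI[of _ "[]"])
next
  case (refl u)
  show ?case by (rule matched_refl)
next
  case (sym u v)
  then show ?case by (simp add: braid_cong_length matched_sym)
next
  case (trans u v w)
  have len: "length v \<le> Suc n"
    using trans.hyps(1) trans.prems by (simp add: braid_cong_length)
  have uv: "matched u v" and vw: "matched v w"
    using len trans.IH trans.prems by simp_all
  show ?case
    by (rule matched_trans[OF _ uv vw len]) (rule cancel)
next
  case (append u u' v v')
  then show ?case by (auto intro: matched_append)
qed

text \<open>
  Cancellation for remainders of length less than \<open>n\<close> gives \<open>matched\<close> for congruent words
  of length at most \<open>n + 1\<close>, which in turn contains cancellation for remainders of length \<open>n\<close>.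
\<close>

lemma braid_cong_Cons_cancel: "braid_cong (a # u) (a # v) \<Longrightarrow> braid_cong u v"
proof (induction "length u" arbitrary: a u v rule: less_induct)
  case less
  then have "matched (a # u) (a # v)"
    by (intro braid_cong_matched_step[of "length u"]) auto
  then show ?case by simp
qed

lemma braid_cong_matched: "braid_cong u v \<Longrightarrow> matched u v"
  by (rule braid_cong_matched_step[of "length u"]) (auto intro: braid_cong_Cons_cancel)

lemma braid_cong_Cons_iff: "braid_cong (a # u) (a # v) \<longleftrightarrow> braid_cong u v"
  using braid_cong_Cons braid_cong_Cons_cancel by blast

lemma braid_cong_Cons_distinct_iff:
  assumes "a \<noteq> b"
  shows "braid_cong (a # u) (b # v) \<longleftrightarrow>
    (\<exists>z. braid_cong u (b # a # z) \<and> braid_cong v (a # b # z))"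
proof
  assume "braid_cong (a # u) (b # v)"
  then show "\<exists>z. braid_cong u (b # a # z) \<and> braid_cong v (a # b # z)"
    using braid_cong_matched assms by fastforce
next
  assume "\<exists>z. braid_cong u (b # a # z) \<and> braid_cong v (a # b # z)"
  then show "braid_cong (a # u) (b # v)"
    using braid_cong_braid[OF assms] braid_cong_Cons braid_cong.trans braid_cong.sym by meson
qed

lemma gen_mult_cancel [simp]:
  assumes "s \<in> braid_gens"
  shows "s * x = s * y \<longleftrightarrow> x = y"
proof -
  have "s1 * x = s1 * y \<longleftrightarrow> x = y" "s2 * x = s2 * y \<longleftrightarrow> x = y"
    by (transfer; simp add: braid_cong_Cons_iff)+
  then show ?thesis using assms by (auto simp: braid_gens_def)
qed

lemma gen_mult_eq_iff:
  assumes "s \<in> braid_gens" "t \<in> braid_gens" "s \<noteq> t"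
  shows "s * x = t * y \<longleftrightarrow> (\<exists>z. x = t * s * z \<and> y = s * t * z)"
proof -
  have "s1 * x = s2 * y \<longleftrightarrow> (\<exists>z. x = s2 * s1 * z \<and> y = s1 * s2 * z)"
    by transfer (simp add: braid_cong_Cons_distinct_iff)
  moreover have "s2 * x = s1 * y \<longleftrightarrow> (\<exists>z. x = s1 * s2 * z \<and> y = s2 * s1 * z)"
    by transfer (simp add: braid_cong_Cons_distinct_iff)
  ultimately show ?thesis using assms by (auto simp: braid_gens_def)
qed

lemma braid_monoid3_induct [case_names one gen]:
  assumes "Q 1" "\<And>t x. t \<in> braid_gens \<Longrightarrow> Q x \<Longrightarrow> Q (t * x)"
  shows "Q x"
proof -
  have "Q (abs_braid_monoid3 u)" for u
  proof (induction u)
    case Nil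
    then show ?case using assms(1) by (simp add: one_braid_monoid3_def)
  next
    case (Cons a u)
    have "abs_braid_monoid3 (a # u) = abs_braid_monoid3 [a] * abs_braid_monoid3 u"
      by (simp add: times_braid_monoid3.abs_eq)
    moreover have "abs_braid_monoid3 [a] \<in> braid_gens"
      by (cases a) (auto simp: braid_gens_def s1_def s2_def)
    ultimately show ?case using assms(2) Cons by simp
  qed
  then show ?thesis using Quotient_abs_rep[OF Quotient_braid_monoid3] by metis
qed

lemma mult_left_cancel_braid: "p * x = p * y \<Longrightarrow> x = (y :: braid_monoid3)"
  by (induction p rule: braid_monoid3_induct) (auto simp: mult.assoc)

section \<open>Simple elements and their complements\<close>

text \<open>
  These are the simple elements of Garside theory, the divisors of \<open>s1 s2 s1\<close>, except for \<open>s1 s2 s1\<close>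
  itself, which never occurs as a complement of the others with respect to a generator.
\<close>

definition simples :: "braid_monoid3 set" where
  "simples = {1, s1, s2, s1 * s2, s2 * s1}"

lemma simplesE:
  assumes "w \<in> simples"
  obtains "w = 1" | "w \<in> braid_gens"
    | s t where "s \<in> braid_gens" "t \<in> braid_gens" "s \<noteq> t" "w = s * t"
proof (cases "s1 = s2")
  case True
  have "\<not> braid_cong [S1] [S2]"
    using braid_cong_matched[of "[S1]" "[S2]"] braid_cong_length[of "[]"] by fastforce
  then have "s1 \<noteq> s2" by transfer
  with True show ?thesis by simp
next
  case False
  then show ?thesis
    using assms that(1,2) that(3)[of s1 s2] that(3)[of s2 s1]
    by (auto simp: simples_def braid_gens_def)
qed

lemma one_simple: "1 \<in> simples"
  and gen_simple: "s \<in> braid_gens \<Longrightarrow> s \<in> simples"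
  and gen_mult_simple: "s \<in> braid_gens \<Longrightarrow> t \<in> braid_gens \<Longrightarrow> s \<noteq> t \<Longrightarrow> s * t \<in> simples"
  by (auto simp: simples_def braid_gens_def)

text \<open>
  The element \<open>w v = t w'\<close> is the least common multiple of \<open>w\<close> and \<open>t\<close>. That both complements
  stay among the simple elements is what bounds all later inductions. The only
  non-evident case is \<open>w = s t'\<close> with \<open>t = t' \<noteq> s\<close>: the least common multiple
  is \<open>s t s = t s t\<close>, so that \<open>v = s\<close> and \<open>w' = s t\<close> is \<open>w\<close> itself.
\<close>

lemma simple_complement:
  assumes w: "w \<in> simples" and t: "t \<in> braid_gens"
  obtains v w' where "v \<in> simples" "w' \<in> simples"
    "\<forall>x y. w * x = t * y \<longleftrightarrow> (\<exists>z. x = v * z \<and> y = w' * z)"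
  using w
proof (cases rule: simplesE)
  case 1
  show ?thesis
    by (rule that[of t 1]) (use 1 t in \<open>auto simp: one_simple gen_simple\<close>)
next
  case 2
  show ?thesis
  proof (cases "w = t")
    case True
    show ?thesis
      by (rule that[of 1 1]) (use True t in \<open>auto simp: one_simple\<close>)
  next
    case False
    show ?thesis
      by (rule that[of "t * w" "w * t"])
        (use 2 t False in \<open>simp_all add: gen_mult_simple gen_mult_eq_iff[OF 2 t False]\<close>)
  qed
next
  case (3 s r)
  show ?thesis
  proof (cases "s = t")
    case True
    show ?thesis
      by (rule that[of 1 r]) (use True 3 in \<open>auto simp: one_simple gen_simple mult.assoc\<close>)
  next
    case False
    then have r: "r = t" using 3 t by (auto simp: braid_gens_def)
    have "w * x = t * y \<longleftrightarrow> (\<exists>z. x = s * z \<and> y = s * t * z)" for x y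
      using 3 r gen_mult_eq_iff[of s t "t * x" y] by (auto simp: mult.assoc)
    then show ?thesis
      using that[of s "s * t"] 3 r by (auto simp: gen_simple gen_mult_simple)
  qed
qed

section \<open>Operations that preserve disjoint unions\<close>

lemma image_mult:
  fixes p q :: "'a::monoid_mult"
  shows "(*) (p * q) ` X = (*) p ` (*) q ` X"
  by (simp add: image_image mult.assoc)

lemma disjoint_unions_empty: "{} \<in> disjoint_unions S"
  unfolding disjoint_unions_def by (auto intro!: exI[of _ "{}"] simp: disjoint_def)

lemma disjoint_unions_basic:
  assumes "finite K" "K \<subseteq> S"
  shows "(*) p ` Omega K \<in> disjoint_unions S"
  unfolding disjoint_unions_def
  using assms by (auto intro!: exI[of _ "{(*) p ` Omega K}"] simp: disjoint_def)

lemma disjoint_unions_Omega: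
  assumes "finite K" "K \<subseteq> S"
  shows "Omega K \<in> disjoint_unions S"
  using disjoint_unions_basic[OF assms, of 1] by simp

lemma disjoint_unions_translate_UNIV:
  fixes p :: "'a::monoid_mult"
  shows "range ((*) p) \<in> disjoint_unions S"
  using disjoint_unions_basic[of "{}" S p] by (simp add: Omega_def)

lemma disjoint_unions_Un:
  assumes "X \<in> disjoint_unions S" "Y \<in> disjoint_unions S" "X \<inter> Y = {}"
  shows "X \<union> Y \<in> disjoint_unions S"
proof -
  obtain F G where F: "finite F" "disjoint F"
      "\<forall>X\<in>F. \<exists>p K. finite K \<and> K \<subseteq> S \<and> X = (*) p ` Omega K" "X = \<Union>F"
    and G: "finite G" "disjoint G"
      "\<forall>X\<in>G. \<exists>p K. finite K \<and> K \<subseteq> S \<and> X = (*) p ` Omega K" "Y = \<Union>G"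
    using assms(1,2) unfolding disjoint_unions_def by blast
  have "disjoint (F \<union> G)"
    using F G assms(3) by (intro disjoint_union) auto
  then show ?thesis
    unfolding disjoint_unions_def using F G
    by (intro CollectI exI[of _ "F \<union> G"]) auto
qed

text \<open>
  An operation on sets that respects disjoint unions preserves the collection as soon as it maps each
  \<open>p \<Omega>\<^sub>K\<close> into it. Translations, inverse images, differences and intersections are of this kind.
\<close>

lemma disjoint_unions_preserved:
  assumes X: "X \<in> disjoint_unions S"
    and emp: "f {} = {}"
    and un: "\<And>X Y. f (X \<union> Y) = f X \<union> f Y"
    and disj: "\<And>X Y. X \<inter> Y = {} \<Longrightarrow> f X \<inter> f Y = {}"
    and basic: "\<And>p K. finite K \<Longrightarrow> K \<subseteq> S \<Longrightarrow> f ((*) p ` Omega K) \<in> disjoint_unions T"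
  shows "f X \<in> disjoint_unions T"
proof -
  obtain F where F: "finite F" "disjoint F"
      "\<forall>X\<in>F. \<exists>p K. finite K \<and> K \<subseteq> S \<and> X = (*) p ` Omega K" and XF: "X = \<Union>F"
    using X unfolding disjoint_unions_def by blast
  from F have "f (\<Union>F) \<in> disjoint_unions T"
  proof (induction F)
    case empty
    then show ?case by (simp add: emp disjoint_unions_empty)
  next
    case (insert Y F)
    have "disjoint F"
      using insert.prems(1) by (rule pairwise_subset) auto
    moreover have "Y \<inter> \<Union>F = {}"
      using insert.prems(1) insert.hyps(2) by (auto simp: disjoint_def)
    moreover have "f Y \<in> disjoint_unions T"
      using insert.prems(2) basic by auto
    ultimately have "f Y \<union> f (\<Union>F) \<in> disjoint_unions T"
      using insert.IH insert.prems(2) disj by (intro disjoint_unions_Un) auto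
    then show ?case by (simp add: un)
  qed
  then show ?thesis using XF by simp
qed

lemma finite_subset_braid_gens: "K \<subseteq> braid_gens \<Longrightarrow> finite K"
  by (rule finite_subset) (auto simp: braid_gens_def)

lemma disjoint_unions_translate:
  fixes p :: braid_monoid3
  assumes "X \<in> disjoint_unions S"
  shows "(*) p ` X \<in> disjoint_unions S"
proof (rule disjoint_unions_preserved[OF assms, where f = "(`) ((*) p)"])
  fix q :: braid_monoid3 and K :: "braid_monoid3 set"
  assume "finite K" "K \<subseteq> S"
  then have "(*) (p * q) ` Omega K \<in> disjoint_unions S"
    by (rule disjoint_unions_basic)
  then show "(*) p ` (*) q ` Omega K \<in> disjoint_unions S"
    by (simp add: image_mult)
qed (auto dest: mult_left_cancel_braid)

section \<open>Removing multiples\<close>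

lemma Omega_insert: "Omega (insert k K) = Omega K - range ((*) k)"
  by (auto simp: Omega_def)

text \<open>
  An element outside \<open>s t P\<close> lies outside \<open>s P\<close>, or is \<open>s x\<close> with \<open>x\<close> outside \<open>t P\<close>. In the
  second case it is not a multiple of \<open>t\<close>, since \<open>x\<close> would then lie in \<open>t s P \<subseteq> t P\<close>; so \<open>s \<Omega>\<^bsub>{t}\<^esub>\<close> is
  contained in \<open>\<Omega>\<^sub>K\<close> unless \<open>s \<in> K\<close>, when it is disjoint from \<open>\<Omega>\<^sub>K\<close>.
\<close>

lemma Omega_diff_simple:
  assumes "w \<in> simples" and K: "K \<subseteq> braid_gens"
  shows "Omega K - range ((*) w) \<in> disjoint_unions braid_gens"
  using assms(1)
proof (cases rule: simplesE)
  case 1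
  then show ?thesis by (simp add: disjoint_unions_empty)
next
  case 2
  then have "Omega (insert w K) \<in> disjoint_unions braid_gens"
    using K by (intro disjoint_unions_Omega finite_subset_braid_gens) auto
  then show ?thesis by (simp add: Omega_insert)
next
  case (3 s t)
  have 1: "Omega (insert s K) \<in> disjoint_unions braid_gens"
    using K 3 by (intro disjoint_unions_Omega finite_subset_braid_gens) auto
  show ?thesis
  proof (cases "s \<in> K")
    case True
    then have "Omega K - range ((*) w) = Omega (insert s K)"
      using 3 by (auto simp: Omega_def mult.assoc)
    then show ?thesis using 1 by simp
  next
    case False
    have Ks: "k = t" if "k \<in> K" for k
      using that False K 3 by (auto simp: braid_gens_def)
    have s_Omega: "s * x \<in> Omega K" if "x \<notin> range ((*) t)" for x
    proof -
      have "s * x \<noteq> t * y" for y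
        using that gen_mult_eq_iff[of s t x y] 3 by (auto simp: mult.assoc)
      then show ?thesis using Ks by (auto simp: Omega_def)
    qed
    have "range ((*) s) - range ((*) w) = (*) s ` Omega {t}"
      using 3 by (auto simp: Omega_def mult.assoc)
    moreover have "range ((*) w) \<subseteq> range ((*) s)"
      using 3 by (auto simp: mult.assoc)
    moreover have "(*) s ` Omega {t} \<subseteq> Omega K"
    proof
      fix y assume "y \<in> (*) s ` Omega {t}"
      then obtain x where "y = s * x" "x \<notin> range ((*) t)"
        by (auto simp: Omega_def)
      then show "y \<in> Omega K" using s_Omega by simp
    qed
    ultimately have "Omega K - range ((*) w) = Omega (insert s K) \<union> (*) s ` Omega {t}"
      unfolding Omega_insert by blast
    moreover have "Omega (insert s K) \<inter> (*) s ` Omega {t} = {}"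
      by (auto simp: Omega_def)
    ultimately show ?thesis
      using 1 3 disjoint_unions_basic[of "{t}" braid_gens s] by (auto intro: disjoint_unions_Un)
  qed
qed

text \<open>
  The first letter \<open>t\<close> of \<open>t q\<close> is removed at the cost of replacing \<open>w\<close> by its complement:
  \<open>t Y - w P = t (Y - w' P)\<close>.
\<close>

lemma basic_diff_simple:
  assumes "w \<in> simples" and K: "K \<subseteq> braid_gens"
  shows "(*) q ` Omega K - range ((*) w) \<in> disjoint_unions braid_gens"
  using assms(1)
proof (induction q arbitrary: w rule: braid_monoid3_induct)
  case one
  then show ?case using Omega_diff_simple K by simp
next
  case (gen t q)
  obtain v w' where vw: "v \<in> simples" "w' \<in> simples"
    "\<forall>x y. w * x = t * y \<longleftrightarrow> (\<exists>z. x = v * z \<and> y = w' * z)"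
    using simple_complement[OF gen.prems gen.hyps] by blast
  have "t * y \<in> range ((*) w) \<longleftrightarrow> y \<in> range ((*) w')" for y
    using vw(3) by (metis rangeE rangeI)
  then have "(*) t ` Y - range ((*) w) = (*) t ` (Y - range ((*) w'))" for Y
    by auto
  then have "(*) (t * q) ` Omega K - range ((*) w) =
      (*) t ` ((*) q ` Omega K - range ((*) w'))"
    by (simp add: image_mult)
  then show ?case
    using gen.IH[OF vw(2)] by (simp add: disjoint_unions_translate)
qed

lemma disjoint_unions_diff_simple:
  assumes "X \<in> disjoint_unions braid_gens" "w \<in> simples"
  shows "X - range ((*) w) \<in> disjoint_unions braid_gens"
  by (rule disjoint_unions_preserved[OF assms(1), where f = "\<lambda>X. X - range ((*) w)"])
    (auto intro: basic_diff_simple assms(2))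

section \<open>Inverse images under left multiplication\<close>

text \<open>
  The inverse image of \<open>k P\<close> under multiplication by \<open>w\<close> is \<open>v P\<close> for a simple element \<open>v\<close>, so the
  inverse image of \<open>\<Omega>\<^sub>K\<close> arises from \<open>P\<close> by removing such sets one after another.
\<close>

lemma vimage_simple_Omega:
  assumes w: "w \<in> simples" and "K \<subseteq> braid_gens"
  shows "(*) w -` Omega K \<in> disjoint_unions braid_gens"
  using finite_subset_braid_gens[OF assms(2)] assms(2)
proof (induction K)
  case empty
  then show ?case
    using disjoint_unions_Omega[of "{}" braid_gens] by (simp add: Omega_def)
next
  case (insert k K)
  obtain v w' where vw: "v \<in> simples" "w' \<in> simples"
    "\<forall>x y. w * x = k * y \<longleftrightarrow> (\<exists>z. x = v * z \<and> y = w' * z)"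
    using simple_complement[OF w, of k] insert.prems by blast
  have "w * x \<in> range ((*) k) \<longleftrightarrow> x \<in> range ((*) v)" for x
    using vw(3) by (auto simp: image_iff)
  then have "(*) w -` Omega (insert k K) = (*) w -` Omega K - range ((*) v)"
    by (auto simp: Omega_insert)
  then show ?case
    using insert vw(1) by (simp add: disjoint_unions_diff_simple)
qed

text \<open>
  With the least common multiple \<open>w v = t w'\<close>, the inverse image of \<open>t Y\<close> under multiplication by \<open>w\<close>
  is \<open>v\<close> times the inverse image of \<open>Y\<close> under multiplication by \<open>w'\<close>. Although \<open>w'\<close> may be longer
  than \<open>w\<close>, it is simple again, which is why the induction on \<open>q\<close> treats all simple \<open>w\<close> together.
\<close>

lemma vimage_simple_basic:
  assumes "w \<in> simples" and K: "K \<subseteq> braid_gens"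
  shows "(*) w -` ((*) q ` Omega K) \<in> disjoint_unions braid_gens"
  using assms(1)
proof (induction q arbitrary: w rule: braid_monoid3_induct)
  case one
  then show ?case using vimage_simple_Omega K by simp
next
  case (gen t q)
  obtain v w' where vw: "v \<in> simples" "w' \<in> simples"
    "\<forall>x y. w * x = t * y \<longleftrightarrow> (\<exists>z. x = v * z \<and> y = w' * z)"
    using simple_complement[OF gen.prems gen.hyps] by blast
  have "(*) w -` ((*) t ` Y) = (*) v ` ((*) w' -` Y)" for Y
  proof -
    have "w * (v * z) = t * (w' * z)" for z
      using vw(3) by blast
    moreover have "\<exists>z. x = v * z \<and> y = w' * z" if "w * x = t * y" for x y
      using vw(3) that by blast
    ultimately show ?thesis by fastforce
  qed
  then have "(*) w -` ((*) (t * q) ` Omega K) = (*) v ` ((*) w' -` ((*) q ` Omega K))"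
    by (simp add: image_mult)
  then show ?case
    using gen.IH[OF vw(2)] by (simp add: disjoint_unions_translate)
qed

lemma disjoint_unions_vimage:
  assumes "X \<in> disjoint_unions braid_gens"
  shows "(*) p -` X \<in> disjoint_unions braid_gens"
  using assms
proof (induction p arbitrary: X rule: braid_monoid3_induct)
  case one
  then show ?case by simp
next
  case (gen t p)
  have "(*) t -` X \<in> disjoint_unions braid_gens"
    by (rule disjoint_unions_preserved[OF gen.prems, where f = "\<lambda>X. (*) t -` X"])
      (auto intro: vimage_simple_basic gen_simple gen.hyps)
  moreover have "(*) (t * p) -` X = (*) p -` ((*) t -` X)"
    by (auto simp: mult.assoc)
  ultimately show ?case using gen.IH by simp
qed

section \<open>Intersections and complements\<close>

lemma disjoint_unions_Int_Omega:
  assumes X: "X \<in> disjoint_unions braid_gens" and "K \<subseteq> braid_gens"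
  shows "X \<inter> Omega K \<in> disjoint_unions braid_gens"
  using finite_subset_braid_gens[OF assms(2)] assms(2)
proof (induction K)
  case empty
  then show ?case using X by (simp add: Omega_def)
next
  case (insert k K)
  have "X \<inter> Omega (insert k K) = (X \<inter> Omega K) - range ((*) k)"
    by (auto simp: Omega_insert)
  then show ?case
    using insert by (simp add: disjoint_unions_diff_simple gen_simple)
qed

lemma disjoint_unions_Int:
  assumes X: "X \<in> disjoint_unions braid_gens" and Y: "Y \<in> disjoint_unions braid_gens"
  shows "X \<inter> Y \<in> disjoint_unions braid_gens"
proof (rule disjoint_unions_preserved[OF Y, where f = "\<lambda>Y. X \<inter> Y"])
  fix p :: braid_monoid3 and K
  assume "K \<subseteq> braid_gens"
  then have "(*) p ` ((*) p -` X \<inter> Omega K) \<in> disjoint_unions braid_gens"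
    using X by (intro disjoint_unions_translate disjoint_unions_Int_Omega disjoint_unions_vimage)
  moreover have "(*) p ` ((*) p -` X \<inter> Omega K) = X \<inter> (*) p ` Omega K"
    by auto
  ultimately show "X \<inter> (*) p ` Omega K \<in> disjoint_unions braid_gens" by simp
qed auto

lemma Compl_Omega:
  assumes "K \<subseteq> braid_gens"
  shows "- Omega K \<in> disjoint_unions braid_gens"
  using finite_subset_braid_gens[OF assms] assms
proof (induction K)
  case empty
  then show ?case by (simp add: Omega_def disjoint_unions_empty)
next
  case (insert k K)
  have "- Omega (insert k K) = range ((*) k) \<union> (- Omega K - range ((*) k))"
    by (auto simp: Omega_insert)
  moreover have "- Omega K - range ((*) k) \<in> disjoint_unions braid_gens"
    using insert by (intro disjoint_unions_diff_simple gen_simple) auto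
  ultimately show ?case
    using disjoint_unions_Un[OF disjoint_unions_translate_UNIV] by (metis Diff_disjoint)
qed

lemma Compl_basic:
  assumes "K \<subseteq> braid_gens"
  shows "- ((*) q ` Omega K) \<in> disjoint_unions braid_gens"
proof (induction q rule: braid_monoid3_induct)
  case one
  then show ?case using Compl_Omega[OF assms] by simp
next
  case (gen t q)
  have "- ((*) t ` Y) = Omega {t} \<union> (*) t ` (- Y)" for Y
    using gen.hyps by (auto simp: Omega_def)
  then have "- ((*) (t * q) ` Omega K) = Omega {t} \<union> (*) t ` (- ((*) q ` Omega K))"
    by (simp add: image_mult)
  moreover have "Omega {t} \<inter> (*) t ` Y = {}" for Y
    by (auto simp: Omega_def)
  moreover have "Omega {t} \<in> disjoint_unions braid_gens"
    using gen.hyps by (intro disjoint_unions_Omega) auto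
  ultimately show ?case
    using gen.IH by (simp add: disjoint_unions_Un disjoint_unions_translate)
qed

lemma disjoint_unions_Compl:
  assumes "X \<in> disjoint_unions braid_gens"
  shows "- X \<in> disjoint_unions braid_gens"
proof -
  obtain F where F: "finite F"
      "\<forall>X\<in>F. \<exists>p K. finite K \<and> K \<subseteq> braid_gens \<and> X = (*) p ` Omega K" and XF: "X = \<Union>F"
    using assms unfolding disjoint_unions_def by blast
  from F have "- \<Union>F \<in> disjoint_unions braid_gens"
  proof (induction F)
    case empty
    then show ?case
      using disjoint_unions_translate_UNIV[of "1 :: braid_monoid3"] by simp
  next
    case (insert Y F)
    then have "- Y \<inter> - \<Union>F \<in> disjoint_unions braid_gens"
      by (intro disjoint_unions_Int) (auto intro: Compl_basic)
    then show ?case by simp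
  qed
  then show ?thesis using XF by simp
qed

theorem proposition7p7:
  shows "algebra (UNIV :: braid_monoid3 set) (disjoint_unions braid_gens)"
  unfolding algebra_iff_Int
  by (auto simp: disjoint_unions_empty disjoint_unions_Int Compl_eq_Diff_UNIV[symmetric]
      intro: disjoint_unions_Compl)

end
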